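(* Let $\mu\in\mathbb{R}$, $\sigma>0$, $\tau>0$. Suppose $\Delta\sim N(\mu,\tau^2)$ (the prior $\pi$) and, given $\Delta$, $X\sim N(\Delta,\sigma^2)$. For $\beta\in\mathbb{R}$ let $\delta_\beta(x)=\mathbf{1}\{x>\beta\}$, with Bayes risk $$r(\pi,\delta_\beta)=\mathbb{E}\left[-\Delta\,\mathbf{1}\{X>\beta\}\right]=\mathbb{E}_{\Delta\sim\pi}\left[-\Delta\,\Phi\!\left(\frac{\Delta-\beta}{\sigma}\right)\right],$$ where $\Phi$ is the standard normal cumulative distribution function. Then $$\beta=\frac{-\mu\sigma^2}{\tau^2}$$ minimizes the Bayes risk $r(\pi,\delta_\beta)$ over $\beta\in\mathbb{R}$.
   Context: Setting: a real unknown $\Delta$ (the true lift) has prior distribution $\pi$, and $X$ is a noisy observation of it with known variance $\sigma^2$. The action space is $\{0,1\}$ ($a=1$ means "ship"), and the loss is $L(\Delta,a)=-a\Delta$. A decision rule is a map $\delta$ from observations to $\{0,1\}$. Its risk is $R(\Delta,\delta)=\mathbb{E}[L(\Delta,\delta(X))\mid\Delta]$ and its Bayes risk is $r(\pi,\delta)=\mathbb{E}_{\Delta\sim\pi}[R(\Delta,\delta)]$. The rules considered are the thresholding rules $\delta_\beta$, $\beta\in\mathbb{R}$. *)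

theory Defs
  imports "HOL-Probability.Probability"
begin

text \<open>
  The second argument of \<^const>\<open>normal_density\<close> is the standard deviation, so
  \<open>normal_law m s\<close> is $N(m, s^2)$; it is meant for \<open>s > 0\<close>.
\<close>
definition normal_law :: "real \<Rightarrow> real \<Rightarrow> real measure" where
  "normal_law m s = density lborel (\<lambda>x. ennreal (normal_density m s x))"

text \<open>
  The Markov kernel \<open>K\<close> is a regular conditional distribution of \<open>Y\<close> given \<open>X\<close> under \<open>M\<close>.
\<close>
definition cond_law :: "'a measure \<Rightarrow> ('a \<Rightarrow> real) \<Rightarrow> ('a \<Rightarrow> real) \<Rightarrow> (real \<Rightarrow> real measure) \<Rightarrow> bool" where
  "cond_law M Y X K \<longleftrightarrow>
     K \<in> borel \<rightarrow>\<^sub>M prob_algebra borel \<and>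
     (\<forall>A\<in>sets borel. \<forall>B\<in>sets borel.
        measure M {\<omega> \<in> space M. X \<omega> \<in> A \<and> Y \<omega> \<in> B}
          = (LINT x:A|distr M borel X. measure (K x) B))"

text \<open>Actions and decision rules take the values 0 and 1, viewed as real numbers.\<close>
definition loss :: "real \<Rightarrow> real \<Rightarrow> real" where
  "loss d a = - a * d"

text \<open>In the next two definitions \<open>K d\<close> is the law of the observation when the true lift is \<open>d\<close>.\<close>
definition risk :: "(real \<Rightarrow> real measure) \<Rightarrow> real \<Rightarrow> (real \<Rightarrow> real) \<Rightarrow> real" where
  "risk K d \<delta> = (LINT x|K d. loss d (\<delta> x))"

definition bayes_risk :: "real measure \<Rightarrow> (real \<Rightarrow> real measure) \<Rightarrow> (real \<Rightarrow> real) \<Rightarrow> real" where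
  "bayes_risk \<pi> K \<delta> = (LINT d|\<pi>. risk K d \<delta>)"

definition threshold_rule :: "real \<Rightarrow> real \<Rightarrow> real" where
  "threshold_rule \<beta> x = indicator {\<beta><..} x"

definition Phi :: "real \<Rightarrow> real" where
  "Phi = cdf std_normal_distribution"

end

theory Submission
  imports Defs
begin

text \<open>
  Let \<open>m(x) = (\<sigma>\<^sup>2 \<mu> + \<tau>\<^sup>2 x) / (\<sigma>\<^sup>2 + \<tau>\<^sup>2)\<close> be the posterior mean of \<open>\<Delta>\<close> given \<open>X = x\<close>, and let \<open>q\<close> be
  the marginal density of \<open>X\<close>, that of \<open>N(\<mu>, \<sigma>\<^sup>2 + \<tau>\<^sup>2)\<close>. Conditioning on \<open>X\<close> instead of on \<open>\<Delta>\<close>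
  turns the Bayes risk of the threshold \<open>\<beta>\<close> into \<open>- \<integral> m(x) q(x) 1{x > \<beta>} dx\<close>. To make this small, one
  should include exactly those \<open>x\<close> at which \<open>m(x)\<close> is positive. As \<open>m\<close> is increasing with its zero at
  \<open>- \<mu> \<sigma>\<^sup>2 / \<tau>\<^sup>2\<close>, these \<open>x\<close> form the half-line above that point, so the corresponding threshold
  rule is optimal pointwise in \<open>x\<close>.

  The exchange of conditioning is Bayes' formula for normal densities
  (\<open>normal_density_posterior\<close>) followed by Fubini's theorem (\<open>integral_posterior_mean\<close>). The two
  other expressions for the Bayes risk come from disintegrating the joint law
  (\<open>integral_cond_law\<close>) and from standardising the observation
  (\<open>measure_normal_law_greaterThan\<close>).
\<close>

section \<open>Disintegration of the joint law\<close>

text \<open>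
  The definition of a conditional law speaks about rectangles only; this extends it to integrands.
  For fixed \<open>B\<close>, the law of \<open>X\<close> restricted to the event \<open>Y \<in> B\<close> and the law of \<open>X\<close> weighted by
  \<open>K x B\<close> are two measures that agree on every Borel set, hence have the same integrals.
\<close>
lemma integral_cond_law:
  fixes f :: "real \<Rightarrow> real"
  assumes M: "prob_space M"
    and X [measurable]: "X \<in> borel_measurable M" and Y [measurable]: "Y \<in> borel_measurable M"
    and K: "cond_law M Y X K"
    and B [measurable]: "B \<in> sets borel" and f [measurable]: "f \<in> borel_measurable borel"
  shows "(LINT \<omega>|M. f (X \<omega>) * indicator {\<omega>. Y \<omega> \<in> B} \<omega>)
           = (LINT x|distr M borel X. f x * measure (K x) B)"
proof -
  interpret prob_space M by (rule M)
  interpret D: prob_space "distr M borel X" by (rule prob_space_distr) simp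
  have K1 [measurable]: "K \<in> borel \<rightarrow>\<^sub>M prob_algebra borel"
    and K2: "\<And>A B. A \<in> sets borel \<Longrightarrow> B \<in> sets borel \<Longrightarrow>
        measure M {\<omega> \<in> space M. X \<omega> \<in> A \<and> Y \<omega> \<in> B}
          = (LINT x:A|distr M borel X. measure (K x) B)"
    using K unfolding cond_law_def by auto
  have g [measurable]: "(\<lambda>x. measure (K x) B) \<in> borel_measurable borel"
    by (rule measurable_compose[OF K1 measurable_measure_prob_algebra]) (rule B)
  have K_le: "measure (K x) B \<le> 1" for x
  proof -
    have "K x \<in> space (prob_algebra borel)"
      using measurable_space[OF K1] by simp
    then interpret Kx: prob_space "K x"
      by (simp add: space_prob_algebra)
    show ?thesis by (rule Kx.prob_le_1)
  qed
  define S where "S = {\<omega> \<in> space M. Y \<omega> \<in> B}"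
  have S [measurable]: "S \<in> sets M" unfolding S_def by measurable
  have eq: "distr (density M (\<lambda>\<omega>. ennreal (indicator S \<omega>))) borel X
      = density (distr M borel X) (\<lambda>x. ennreal (measure (K x) B))"
  proof (rule measure_eqI)
    fix A assume "A \<in> sets (distr (density M (\<lambda>\<omega>. ennreal (indicator S \<omega>))) borel X)"
    then have A [measurable]: "A \<in> sets borel" by simp
    have "emeasure (distr (density M (\<lambda>\<omega>. ennreal (indicator S \<omega>))) borel X) A
        = (\<integral>\<^sup>+\<omega>. ennreal (indicator S \<omega>) * indicator (X -` A \<inter> space M) \<omega> \<partial>M)"
      by (simp add: emeasure_distr emeasure_density)
    also have "\<dots> = (\<integral>\<^sup>+\<omega>. indicator {\<omega> \<in> space M. X \<omega> \<in> A \<and> Y \<omega> \<in> B} \<omega> \<partial>M)"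
      by (rule nn_integral_cong) (auto simp: S_def indicator_def)
    also have "\<dots> = emeasure M {\<omega> \<in> space M. X \<omega> \<in> A \<and> Y \<omega> \<in> B}"
      by (rule nn_integral_indicator) measurable
    also have "\<dots> = ennreal (LINT x:A|distr M borel X. measure (K x) B)"
      by (simp add: emeasure_eq_measure K2)
    also have "\<dots> = (\<integral>\<^sup>+x. ennreal (indicator A x * measure (K x) B) \<partial>distr M borel X)"
      unfolding set_lebesgue_integral_def real_scaleR_def
      by (rule nn_integral_eq_integral[symmetric])
         (auto intro!: D.integrable_const_bound[where B=1] simp: indicator_def K_le)
    also have "\<dots> = emeasure (density (distr M borel X) (\<lambda>x. ennreal (measure (K x) B))) A"
      by (subst emeasure_density)
         (auto intro!: nn_integral_cong simp: indicator_def)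
    finally show "emeasure (distr (density M (\<lambda>\<omega>. ennreal (indicator S \<omega>))) borel X) A
        = emeasure (density (distr M borel X) (\<lambda>x. ennreal (measure (K x) B))) A" .
  qed simp
  have "(LINT \<omega>|M. f (X \<omega>) * indicator {\<omega>. Y \<omega> \<in> B} \<omega>)
      = (LINT \<omega>|M. indicator S \<omega> *\<^sub>R f (X \<omega>))"
    by (rule Bochner_Integration.integral_cong) (auto simp: S_def indicator_def)
  also have "\<dots> = (LINT x|distr (density M (\<lambda>\<omega>. ennreal (indicator S \<omega>))) borel X. f x)"
    by (subst integral_distr) (auto simp: integral_density)
  also have "\<dots> = (LINT x|distr M borel X. f x * measure (K x) B)"
    unfolding eq by (subst integral_density) (auto simp: mult.commute)
  finally show ?thesis .
qed

section \<open>Normal laws\<close>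

lemma prob_space_normal_law: "0 < s \<Longrightarrow> prob_space (normal_law m s)"
  unfolding normal_law_def by (rule prob_space_normal_density)

lemma integral_normal_law:
  "f \<in> borel_measurable borel \<Longrightarrow>
    (LINT x|normal_law m s. f x) = (LINT x|lborel. normal_density m s x * f x)" for f :: "real \<Rightarrow> real"
  unfolding normal_law_def by (subst integral_density) auto

lemma measure_normal_law:
  assumes [measurable]: "A \<in> sets borel"
  shows "measure (normal_law m s) A = (LINT x|lborel. normal_density m s x * indicator A x)"
proof -
  have "space (normal_law m s) = UNIV" by (simp add: normal_law_def)
  then have "measure (normal_law m s) A = (LINT x|normal_law m s. indicator A x)"
    by simp
  also have "\<dots> = (LINT x|lborel. normal_density m s x * indicator A x)"
    by (rule integral_normal_law) simp
  finally show ?thesis .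
qed

text \<open>The reflection \<open>u \<mapsto> m - s u\<close> turns upper tails of \<open>N(m, s\<^sup>2)\<close> into values of \<open>Phi\<close>.\<close>
lemma normal_density_reflect_standardise:
  "0 < s \<Longrightarrow> s * normal_density m s (m + (- s) * u) = std_normal_density u"
  by (simp add: normal_density_def real_sqrt_mult power_mult_distrib)

lemma measure_normal_law_greaterThan:
  assumes s: "0 < s"
  shows "measure (normal_law m s) {b<..} = Phi ((m - b) / s)"
proof -
  let ?z = "(m - b) / s"
  have iff: "b < m + (- s) * u \<longleftrightarrow> u < ?z" for u
    using s by (simp add: field_simps)
  have "measure (normal_law m s) {b<..} = (LINT x|lborel. normal_density m s x * indicator {b<..} x)"
    by (rule measure_normal_law) simp
  also have "\<dots> = \<bar>- s\<bar> *\<^sub>R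
      (LINT u|lborel. normal_density m s (m + (- s) * u) * indicator {b<..} (m + (- s) * u))"
    by (rule lborel_integral_real_affine) (use s in simp)
  also have "\<dots> = s *
      (LINT u|lborel. normal_density m s (m + (- s) * u) * indicator {b<..} (m + (- s) * u))"
    using s by simp
  also have "\<dots> =
      (LINT u|lborel. s * (normal_density m s (m + (- s) * u) * indicator {b<..} (m + (- s) * u)))"
    by (rule integral_mult_right_zero[symmetric])
  also have "\<dots> = (LINT u|lborel. s * normal_density m s (m + (- s) * u) * indicator {..<?z} u)"
    unfolding indicator_def greaterThan_iff lessThan_iff iff by (simp only: mult.assoc)
  also have "\<dots> = (LINT u|lborel. std_normal_density u * indicator {..<?z} u)"
    by (simp only: normal_density_reflect_standardise[OF s])
  \<comment> \<open>The strict and the weak half-line differ by a Lebesgue null set.\<close>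
  also have "\<dots> = (LINT u|lborel. std_normal_density u * indicator {..?z} u)"
    by (rule integral_cong_AE) (use AE_lborel_singleton[of ?z] in \<open>auto simp: indicator_def elim!: eventually_mono\<close>)
  also have "\<dots> = measure (normal_law 0 1) {..?z}"
    by (simp add: measure_normal_law)
  finally show ?thesis by (simp add: Phi_def cdf_def normal_law_def)
qed

section \<open>The posterior mean\<close>

text \<open>
  Completing the square in \<open>d\<close>: the exponents of prior and likelihood regroup into one for the
  marginal of \<open>x\<close> and one for the posterior of \<open>d\<close>. Here \<open>s\<close> and \<open>t\<close> are the noise and prior variances.
\<close>
lemma complete_square_posterior:
  fixes s t :: real
  assumes "0 < s" "0 < t"
  shows "(d - \<mu>)\<^sup>2 / (2 * t) + (x - d)\<^sup>2 / (2 * s)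
      = (x - \<mu>)\<^sup>2 / (2 * (s + t)) + (d - (s * \<mu> + t * x) / (s + t))\<^sup>2 / (2 * (s * t / (s + t)))"
proof -
  define S where "S = s + t"
  have S: "S \<noteq> 0" "s \<noteq> 0" "t \<noteq> 0" using assms by (auto simp: S_def)
  have "(d - \<mu>)\<^sup>2 * s * S + (x - d)\<^sup>2 * t * S = (x - \<mu>)\<^sup>2 * s * t + (d * S - (s * \<mu> + t * x))\<^sup>2"
    unfolding S_def by algebra
  moreover have "d - (s * \<mu> + t * x) / S = (d * S - (s * \<mu> + t * x)) / S"
    using S by (simp add: diff_divide_distrib)
  moreover have "(d - \<mu>)\<^sup>2 / (2 * t) + (x - d)\<^sup>2 / (2 * s) = ((d - \<mu>)\<^sup>2 * s * S + (x - d)\<^sup>2 * t * S) / (2 * s * t * S)"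
    using S by (simp add: add_divide_distrib)
  moreover have "(x - \<mu>)\<^sup>2 / (2 * S) + (A / S)\<^sup>2 / (2 * (s * t / S)) = ((x - \<mu>)\<^sup>2 * s * t + A\<^sup>2) / (2 * s * t * S)" for A
    using S by (simp add: add_divide_distrib power_divide power2_eq_square[of S])
  ultimately show ?thesis unfolding S_def by simp
qed
text \<open>
  The joint density of lift and observation factors as marginal density of the observation times
  posterior density of the lift. The posterior is again normal; its mean is affine in \<open>x\<close> with
  positive slope, and this monotonicity makes thresholding optimal.
\<close>
lemma normal_density_posterior:
  assumes [simp, arith]: "0 < \<sigma>" "0 < \<tau>"
  shows "normal_density \<mu> \<tau> d * normal_density d \<sigma> x
    = normal_density \<mu> (sqrt (\<sigma>\<^sup>2 + \<tau>\<^sup>2)) x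
      * normal_density ((\<sigma>\<^sup>2 * \<mu> + \<tau>\<^sup>2 * x) / (\<sigma>\<^sup>2 + \<tau>\<^sup>2)) (sqrt (\<sigma>\<^sup>2 * \<tau>\<^sup>2 / (\<sigma>\<^sup>2 + \<tau>\<^sup>2))) d"
proof -
  define s t where "s = \<sigma>\<^sup>2" and "t = \<tau>\<^sup>2"
  then have [simp, arith]: "0 < s" "0 < t" by simp_all
  have sqrt: "sqrt (2 * pi * (s + t)) * sqrt (2 * pi * (s * t) / (s + t))
      = sqrt (2 * pi * t) * sqrt (2 * pi * s)"
    by (simp add: real_sqrt_mult[symmetric])
  note expo = complete_square_posterior[OF \<open>0 < s\<close> \<open>0 < t\<close>, of d \<mu> x]
  have "normal_density \<mu> \<tau> d * normal_density d \<sigma> x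
      = exp (- ((d - \<mu>)\<^sup>2 / (2 * t) + (x - d)\<^sup>2 / (2 * s))) / (sqrt (2 * pi * t) * sqrt (2 * pi * s))"
    by (simp add: normal_density_def mult_exp_exp flip: s_def t_def)
  also have "\<dots> = normal_density \<mu> (sqrt (s + t)) x
      * normal_density ((s * \<mu> + t * x) / (s + t)) (sqrt (s * t / (s + t))) d"
    unfolding expo sqrt[symmetric] by (simp add: normal_density_def mult_exp_exp)
  finally show ?thesis by (simp add: s_def t_def)
qed

text \<open>
  Reversing the order of conditioning. Integrating the joint density against \<open>d\<close> over \<open>x \<in> B\<close> first
  gives the left-hand side, integrating over \<open>d\<close> first gives the marginal density times the
  posterior mean. Fubini's theorem applies since the prior has a finite first moment.
\<close>
lemma
  fixes \<mu> \<sigma> \<tau> :: real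
  assumes \<sigma>: "0 < \<sigma>" and \<tau>: "0 < \<tau>" and B [measurable]: "B \<in> sets borel"
  defines "h \<equiv> \<lambda>x. normal_density \<mu> (sqrt (\<sigma>\<^sup>2 + \<tau>\<^sup>2)) x
              * ((\<sigma>\<^sup>2 * \<mu> + \<tau>\<^sup>2 * x) / (\<sigma>\<^sup>2 + \<tau>\<^sup>2))"
  shows integrable_posterior_mean: "integrable lborel (\<lambda>x. h x * indicator B x)"
    and integral_posterior_mean: "(LINT d|normal_law \<mu> \<tau>. d * measure (normal_law d \<sigma>) B)
           = (LINT x|lborel. h x * indicator B x)"
proof -
  define f where "f d x = d * normal_density \<mu> \<tau> d * (normal_density d \<sigma> x * indicator B x)" for d x :: real
  have meas [measurable]: "(\<lambda>(d, x). normal_density d \<sigma> x) \<in> borel_measurable (borel \<Otimes>\<^sub>M borel)"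
    unfolding normal_density_def by measurable
  have [measurable]: "case_prod f \<in> borel_measurable (lborel \<Otimes>\<^sub>M lborel)"
    unfolding f_def by measurable
  have int_B: "integrable lborel (\<lambda>x. normal_density d \<sigma> x * indicator B x)" for d
    using integrable_real_mult_indicator[of B lborel "normal_density d \<sigma>"] \<sigma> by simp
  have le1: "(LINT x|lborel. normal_density d \<sigma> x * indicator B x) \<le> 1" for d
  proof -
    interpret prob_space "normal_law d \<sigma>" using \<sigma> by (rule prob_space_normal_law)
    show ?thesis using prob_le_1[of B] by (simp add: measure_normal_law)
  qed
  have f_int: "integrable (lborel \<Otimes>\<^sub>M lborel) (case_prod f)"
  proof (rule lborel_pair.Fubini_integrable)
    have nn: "0 \<le> (LINT x|lborel. normal_density d \<sigma> x * indicator B x)" for d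
      by (rule integral_nonneg_AE) simp
    \<comment> \<open>The inner mass is at most 1, which leaves the first absolute moment of the prior as a bound.\<close>
    have "(LINT x|lborel. norm (case_prod f (d, x)))
        = \<bar>d * normal_density \<mu> \<tau> d\<bar> * (LINT x|lborel. normal_density d \<sigma> x * indicator B x)" for d
      by (simp add: f_def abs_mult)
    moreover have "\<bar>d * normal_density \<mu> \<tau> d\<bar> * (LINT x|lborel. normal_density d \<sigma> x * indicator B x)
        \<le> norm (normal_density \<mu> \<tau> d * d)" for d
      using mult_left_le[OF le1[of d], of "\<bar>d * normal_density \<mu> \<tau> d\<bar>"] by (simp add: mult.commute)
    ultimately have "norm (LINT x|lborel. norm (case_prod f (d, x))) \<le> norm (normal_density \<mu> \<tau> d * d)" for d
      using nn[of d] by (simp only: real_norm_def abs_mult abs_abs abs_of_nonneg)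
    then show "integrable lborel (\<lambda>d. LINT x|lborel. norm (case_prod f (d, x)))"
      by (intro Bochner_Integration.integrable_bound[OF integrable_normal_moment_nz_1[OF \<tau>, of \<mu>]] AE_I2)
         measurable
  qed (auto simp: f_def int_B)
  have inner_d: "(LINT d|lborel. f d x) = h x * indicator B x" for x
  proof -
    define m v where "m = (\<sigma>\<^sup>2 * \<mu> + \<tau>\<^sup>2 * x) / (\<sigma>\<^sup>2 + \<tau>\<^sup>2)"
      and "v = sqrt (\<sigma>\<^sup>2 * \<tau>\<^sup>2 / (\<sigma>\<^sup>2 + \<tau>\<^sup>2))"
    have v: "0 < v" using \<sigma> \<tau> by (simp add: v_def add_pos_pos)
    have "f d x = (normal_density \<mu> (sqrt (\<sigma>\<^sup>2 + \<tau>\<^sup>2)) x * indicator B x) * (normal_density m v d * d)" for d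
      using normal_density_posterior[OF \<sigma> \<tau>, of \<mu> d x] by (simp add: f_def m_def v_def algebra_simps)
    then show ?thesis
      using integral_normal_moment_nz_1[OF v, of m] by (simp add: h_def m_def)
  qed
  have inner_x: "(LINT x|lborel. f d x) = d * normal_density \<mu> \<tau> d * measure (normal_law d \<sigma>) B" for d
    by (simp only: f_def measure_normal_law[OF B] integral_mult_right_zero)
  show "integrable lborel (\<lambda>x. h x * indicator B x)"
    using lborel_pair.integrable_snd[OF f_int] by (simp add: inner_d)
  have "(\<lambda>d. measure (normal_law d \<sigma>) B) \<in> borel_measurable borel"
    unfolding measure_normal_law[OF B] by measurable
  then have "(LINT d|normal_law \<mu> \<tau>. d * measure (normal_law d \<sigma>) B) = (LINT d|lborel. LINT x|lborel. f d x)"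
    by (subst integral_normal_law) (auto simp: inner_x mult_ac)
  also have "\<dots> = (LINT x|lborel. h x * indicator B x)"
    using lborel_pair.Fubini_integral[OF f_int] by (simp add: inner_d)
  finally show "(LINT d|normal_law \<mu> \<tau>. d * measure (normal_law d \<sigma>) B)
           = (LINT x|lborel. h x * indicator B x)" .
qed

section \<open>The optimal threshold\<close>

lemma risk_threshold_rule:
  "risk (\<lambda>d. normal_law d \<sigma>) d (threshold_rule \<beta>) = - d * measure (normal_law d \<sigma>) {\<beta><..}"
proof -
  have "risk (\<lambda>d. normal_law d \<sigma>) d (threshold_rule \<beta>)
      = (LINT x|normal_law d \<sigma>. (- d) * indicator {\<beta><..} x)"
    by (simp add: risk_def loss_def threshold_rule_def mult.commute)
  also have "\<dots> = - d * measure (normal_law d \<sigma>) {\<beta><..}"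
    by (subst integral_mult_right_zero) (simp add: normal_law_def)
  finally show ?thesis .
qed

theorem theorem2:
  fixes \<mu> \<sigma> \<tau> :: real
    and M :: "'a measure"
    and \<Delta> X :: "'a \<Rightarrow> real"
  assumes "\<sigma> > 0" and "\<tau> > 0"
    and "prob_space M"
    and "\<Delta> \<in> borel_measurable M" and "X \<in> borel_measurable M"
    and "distr M borel \<Delta> = normal_law \<mu> \<tau>"
    and "cond_law M X \<Delta> (\<lambda>d. normal_law d \<sigma>)"
  defines "r \<equiv> \<lambda>\<beta>. bayes_risk (normal_law \<mu> \<tau>) (\<lambda>d. normal_law d \<sigma>) (threshold_rule \<beta>)"
  shows "(\<forall>\<beta>. r \<beta> = (LINT \<omega>|M. - \<Delta> \<omega> * indicator {\<omega>. X \<omega> > \<beta>} \<omega>)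
             \<and> r \<beta> = (LINT d|normal_law \<mu> \<tau>. - d * Phi ((d - \<beta>) / \<sigma>)))
         \<and> (\<forall>\<beta>. r (- \<mu> * \<sigma>\<^sup>2 / \<tau>\<^sup>2) \<le> r \<beta>)"
proof -
  note \<sigma> = \<open>\<sigma> > 0\<close> and \<tau> = \<open>\<tau> > 0\<close>
  have r_eq: "r \<beta> = (LINT d|normal_law \<mu> \<tau>. - d * measure (normal_law d \<sigma>) {\<beta><..})" for \<beta>
    by (simp add: r_def bayes_risk_def risk_threshold_rule)
  have joint: "r \<beta> = (LINT \<omega>|M. - \<Delta> \<omega> * indicator {\<omega>. X \<omega> > \<beta>} \<omega>)" for \<beta>
    using integral_cond_law[OF assms(3) assms(4) assms(5) assms(7), of "{\<beta><..}" uminus]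
    by (simp add: assms(6) r_eq)
  have Phi_form: "r \<beta> = (LINT d|normal_law \<mu> \<tau>. - d * Phi ((d - \<beta>) / \<sigma>))" for \<beta>
    by (simp only: r_eq measure_normal_law_greaterThan[OF \<sigma>])
  define m where "m x = (\<sigma>\<^sup>2 * \<mu> + \<tau>\<^sup>2 * x) / (\<sigma>\<^sup>2 + \<tau>\<^sup>2)" for x
  define h where "h x = normal_density \<mu> (sqrt (\<sigma>\<^sup>2 + \<tau>\<^sup>2)) x * m x" for x
  define b where "b = - \<mu> * \<sigma>\<^sup>2 / \<tau>\<^sup>2"
  have h_int: "integrable lborel (\<lambda>x. h x * indicator {\<beta><..} x)" for \<beta>
    unfolding h_def m_def by (rule integrable_posterior_mean[OF \<sigma> \<tau>]) simp
  have r_h: "r \<beta> = - (LINT x|lborel. h x * indicator {\<beta><..} x)" for \<beta>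
    using integral_posterior_mean[OF \<sigma> \<tau>, of "{\<beta><..}" \<mu>]
    by (simp add: r_eq h_def m_def)
  have m_sign: "0 < m x \<longleftrightarrow> b < x" for x
  proof -
    have "0 < \<sigma>\<^sup>2 + \<tau>\<^sup>2" "0 < \<tau>\<^sup>2" using \<sigma> \<tau> by (simp_all add: add_pos_pos)
    then have "0 < m x \<longleftrightarrow> 0 < \<sigma>\<^sup>2 * \<mu> + \<tau>\<^sup>2 * x" "b < x \<longleftrightarrow> - \<mu> * \<sigma>\<^sup>2 < x * \<tau>\<^sup>2"
      by (simp_all only: m_def b_def zero_less_divide_iff pos_divide_less_eq) auto
    then show ?thesis by (simp add: mult.commute) linarith
  qed
  \<comment> \<open>The indicator of the half-line above \<open>b\<close> selects exactly the positive part of \<open>h\<close>.\<close>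
  have h_le: "h x * indicator {\<beta><..} x \<le> h x * indicator {b<..} x" for x \<beta>
    using m_sign[of x] by (auto simp: h_def indicator_def mult_nonneg_nonpos)
  have "r b \<le> r \<beta>" for \<beta>
    unfolding r_h by (simp add: integral_mono h_int h_le)
  then show ?thesis using joint Phi_form unfolding b_def by blast
qed

end
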